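(* Let $G$ be a finite simple graph on $n$ vertices and $m$ edges, with maximum vertex degree $\Delta$ and minimum vertex degree $\delta>0$, and let $\overline{m}=|E(\overline{G})|$. Then $$2\sqrt{\overline{m}\,\Delta\,\overline{M}_1(G)}\leq \left(1+\frac{\Delta}{\delta}\right)\overline{SO}(G).$$
   Context: All graphs are finite and simple, with nonempty vertex set. $d_G(u)$ denotes the degree of $u$ in $G$, and $\overline{G}$ is the complement of $G$; $\overline{m}=|E(\overline{G})|=\binom{n}{2}-m$. The Sombor coindex and the first Zagreb coindex of $G$ are $$\overline{SO}(G)=\sum_{uv\in E(\overline{G})}\sqrt{d_G(u)^2+d_G(v)^2},\qquad \overline{M}_1(G)=\sum_{uv\in E(\overline{G})}[d_G(u)+d_G(v)],$$ the sums being over unordered pairs of distinct non-adjacent vertices of $G$, with degrees taken in $G$. *)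

theory Defs
  imports Complex_Main
begin

definition vertex_pairs :: "'a set \<Rightarrow> 'a set set" where
  "vertex_pairs V = {e. e \<subseteq> V \<and> card e = 2}"

definition simple_graph :: "'a set \<Rightarrow> 'a set set \<Rightarrow> bool" where
  "simple_graph V E \<longleftrightarrow> finite V \<and> V \<noteq> {} \<and> E \<subseteq> vertex_pairs V"

definition vertex_degree :: "'a set set \<Rightarrow> 'a \<Rightarrow> nat" where
  "vertex_degree E u = card {e \<in> E. u \<in> e}"

definition max_degree :: "'a set \<Rightarrow> 'a set set \<Rightarrow> nat" where
  "max_degree V E = Max (vertex_degree E ` V)"

definition min_degree :: "'a set \<Rightarrow> 'a set set \<Rightarrow> nat" where
  "min_degree V E = Min (vertex_degree E ` V)"

definition complement_edges :: "'a set \<Rightarrow> 'a set set \<Rightarrow> 'a set set" where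
  "complement_edges V E = vertex_pairs V - E"

text \<open>In both coindices the outer sum runs over the unordered non-adjacent pairs
  \<open>e = {u, v}\<close>, \<open>u \<noteq> v\<close>, and the inner sum over \<open>w \<in> e\<close> has the two summands
  \<open>w = u\<close> and \<open>w = v\<close>. Degrees are those of the graph itself, not of its complement.\<close>

definition sombor_coindex :: "'a set \<Rightarrow> 'a set set \<Rightarrow> real" where
  "sombor_coindex V E =
     (\<Sum>e\<in>complement_edges V E. sqrt (\<Sum>w\<in>e. (real (vertex_degree E w))\<^sup>2))"

definition first_zagreb_coindex :: "'a set \<Rightarrow> 'a set set \<Rightarrow> real" where
  "first_zagreb_coindex V E =
     (\<Sum>e\<in>complement_edges V E. \<Sum>w\<in>e. real (vertex_degree E w))"

lemma vertex_pairs_iff: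
  "e \<in> vertex_pairs V \<longleftrightarrow> (\<exists>u v. u \<in> V \<and> v \<in> V \<and> u \<noteq> v \<and> e = {u, v})"
  by (auto simp: vertex_pairs_def card_2_iff)

lemma card_complement_edges:
  assumes "simple_graph V E"
  shows "card (complement_edges V E) = (card V choose 2) - card E"
proof -
  have fin: "finite V" and sub: "E \<subseteq> vertex_pairs V"
    using assms by (auto simp: simple_graph_def)
  have "finite (vertex_pairs V)"
    using fin by (simp add: vertex_pairs_def)
  then have "finite E"
    using sub finite_subset by blast
  then show ?thesis
    using card_Diff_subset[of E "vertex_pairs V"] sub n_subsets[OF fin, of 2]
    by (simp add: complement_edges_def vertex_pairs_def)
qed

end

theory Submission
  imports Defs
begin

text \<open>Every non-adjacent pair with degrees \<open>x, y \<in> [\<delta>, \<Delta>]\<close> has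
  \<open>s = sqrt (x\<^sup>2 + y\<^sup>2)\<close> between \<open>\<surd>2 \<delta>\<close> and \<open>\<surd>2 \<Delta>\<close>. As in the Diaz-Metcalf proof of
  the reversed Cauchy-Schwarz inequality, the sign of \<open>(s - \<surd>2 \<delta>) (\<surd>2 \<Delta> - s)\<close> bounds
  \<open>s\<^sup>2 + 2 \<delta> \<Delta>\<close> by a multiple of \<open>s\<close>; since \<open>x\<^sup>2 \<ge> \<delta> x\<close> and \<open>y\<^sup>2 \<ge> \<delta> y\<close>, it also bounds
  \<open>\<delta> (x + y) + 2 \<delta> \<Delta>\<close>. This is the lemma \<open>degree_pair_bound\<close>. Being linear in the
  summands of both coindices, it sums over the complement edges to
  \<open>M + 2 \<Delta> m \<le> \<surd>2 (1 + \<Delta> / \<delta>) S\<close>, where \<open>M\<close> is the Zagreb coindex, \<open>S\<close> the Sombor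
  coindex and \<open>m\<close> the number of complement edges. The inequality between the arithmetic
  and geometric means of \<open>M\<close> and \<open>2 \<Delta> m\<close> then gives the theorem.\<close>

text \<open>Division by the lower bound \<open>d\<close> puts the estimate in the form in which the factor
  \<open>1 + \<Delta> / \<delta>\<close> of the theorem occurs.\<close>

lemma degree_pair_bound:
  fixes d D x y :: real
  assumes "0 < d" "d \<le> x" "x \<le> D" "d \<le> y" "y \<le> D"
  shows "x + y + 2 * D \<le> sqrt 2 * (1 + D / d) * sqrt (x\<^sup>2 + y\<^sup>2)"
proof -
  define s where "s = sqrt (x\<^sup>2 + y\<^sup>2)"
  have s_sq: "s * s = x\<^sup>2 + y\<^sup>2"
    by (simp add: s_def)
  have "sqrt (2 * d\<^sup>2) \<le> s"
    unfolding s_def using power_mono[of d x 2] power_mono[of d y 2] assms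
    by (intro real_sqrt_le_mono) linarith
  then have lower: "sqrt 2 * d \<le> s"
    using assms by (simp add: real_sqrt_mult)
  have "s \<le> sqrt (2 * D\<^sup>2)"
    unfolding s_def using power_mono[of x D 2] power_mono[of y D 2] assms
    by (intro real_sqrt_le_mono) linarith
  then have upper: "s \<le> sqrt 2 * D"
    using assms by (simp add: real_sqrt_mult)
  have "0 \<le> (s - sqrt 2 * d) * (sqrt 2 * D - s)"
    using lower upper by simp
  also have "\<dots> = sqrt 2 * (d + D) * s - s * s - (sqrt 2 * sqrt 2) * (d * D)"
    by (simp only: algebra_simps)
  finally have "x\<^sup>2 + y\<^sup>2 + 2 * (d * D) \<le> sqrt 2 * (d + D) * s"
    by (simp add: s_sq)
  moreover have "d * x \<le> x\<^sup>2" "d * y \<le> y\<^sup>2"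
    using assms by (auto simp: power2_eq_square intro: mult_right_mono)
  ultimately have "d * (x + y + 2 * D) \<le> sqrt 2 * (d + D) * s"
    by (simp add: algebra_simps)
  also have "\<dots> = d * (sqrt 2 * (1 + D / d) * s)"
    using assms(1) by (simp add: field_simps)
  finally show ?thesis
    using assms(1) by (simp add: s_def)
qed

lemma vertex_degree_bounds:
  assumes "finite V" "u \<in> V"
  shows "min_degree V E \<le> vertex_degree E u" "vertex_degree E u \<le> max_degree V E"
  using assms by (auto simp: min_degree_def max_degree_def)

theorem theorem4p4:
  fixes V :: "'a set" and E :: "'a set set" and \<Delta> \<delta> mbar :: nat
  assumes "simple_graph V E"
    and "\<Delta> = max_degree V E"
    and "\<delta> = min_degree V E"
    and "\<delta> > 0"
    and "mbar = card (complement_edges V E)"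
  shows "2 * sqrt (real mbar * real \<Delta> * first_zagreb_coindex V E)
    \<le> (1 + real \<Delta> / real \<delta>) * sombor_coindex V E"
proof -
  let ?M = "first_zagreb_coindex V E" and ?S = "sombor_coindex V E"
  let ?c = "1 + real \<Delta> / real \<delta>"
  have "finite V"
    using assms(1) by (simp add: simple_graph_def)
  have edge_bound:
    "(\<Sum>w\<in>e. real (vertex_degree E w)) + 2 * real \<Delta>
      \<le> sqrt 2 * ?c * sqrt (\<Sum>w\<in>e. (real (vertex_degree E w))\<^sup>2)"
    if e: "e \<in> complement_edges V E" for e
  proof -
    obtain u v where uv: "u \<in> V" "v \<in> V" "u \<noteq> v" "e = {u, v}"
      using e by (auto simp: complement_edges_def vertex_pairs_iff)
    show ?thesis
      using degree_pair_bound[of "real \<delta>" "real (vertex_degree E u)" "real \<Delta>"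
          "real (vertex_degree E v)"]
        vertex_degree_bounds[OF \<open>finite V\<close> uv(1), of E]
        vertex_degree_bounds[OF \<open>finite V\<close> uv(2), of E] uv assms(2-4)
      by simp
  qed
  have "?M + 2 * real \<Delta> * real mbar =
      (\<Sum>e\<in>complement_edges V E. (\<Sum>w\<in>e. real (vertex_degree E w)) + 2 * real \<Delta>)"
    by (simp add: first_zagreb_coindex_def sum.distrib assms(5))
  also have "\<dots> \<le> sqrt 2 * ?c * ?S"
    unfolding sombor_coindex_def sum_distrib_left by (intro sum_mono edge_bound)
  finally have sum_bound: "?M + 2 * real \<Delta> * real mbar \<le> sqrt 2 * (?c * ?S)"
    by (simp add: mult.assoc)
  have "0 \<le> ?M"
    by (auto simp: first_zagreb_coindex_def intro!: sum_nonneg)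
  then have "sqrt (?M * (2 * real \<Delta> * real mbar)) \<le> (?M + 2 * real \<Delta> * real mbar) / 2"
    by (intro arith_geo_mean_sqrt) auto
  also have "sqrt (?M * (2 * real \<Delta> * real mbar)) =
      sqrt 2 * sqrt (real mbar * real \<Delta> * ?M)"
    by (simp add: real_sqrt_mult mult_ac)
  finally have "sqrt 2 * (2 * sqrt (real mbar * real \<Delta> * ?M)) \<le> ?M + 2 * real \<Delta> * real mbar"
    by simp
  also note sum_bound
  finally show ?thesis
    by (simp only: mult_le_cancel_left_pos real_sqrt_gt_zero zero_less_numeral)
qed

end
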